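(* Consider four anyons of topological charges $2,2,1,1$ (in this order, with total charge $0$) in the Kauffman–Jones version of $SU(2)$ Chern–Simons theory at level $4$. There is a braid, consisting of a single exchange of the second and third anyons followed by exchanges of the first and second anyons, that maps the qubit space $2211$ (with orthonormal basis $|0\rangle,|2\rangle$) to the qubit space $1221$ (with orthonormal basis $|1\rangle,|3\rangle$) such that, up to a phase, the image of $|0\rangle$ is $$\frac{1}{\sqrt2}\big(|1\rangle+|3\rangle\big)$$ and, up to a phase, the image of $|2\rangle$ is $$\frac{1}{\sqrt2}\big(|1\rangle-|3\rangle\big).$$
   Context: The Kauffman–Jones version of $SU(2)$ Chern–Simons theory at level $4$ is the unitary Temperley–Lieb–Jones theory (Kauffman–Lins recoupling theory) at the Kauffman variable $A=i e^{-i\pi/12}$ (loop value $-A^2-A^{-2}=\sqrt3$). Its simple objects (topological charges) are $0,1,2,3,4$. A triple $(a,b,c)$ is admissible (multiplicity one) iff $a+b+c$ is even, $a\le b+c$, $b\le a+c$, $c\le a+b$ and $a+b+c\le 8$; charge $0$ is the vacuum. For four anyons of charges $a_1,a_2,a_3,a_4$ with total charge $0$, the vector $|c\rangle$ denotes the fusion tree in which the first two anyons fuse to $c$, the last two anyons fuse to $c$, and these two charges fuse to $0$, divided by the positive square root of its squared norm. For charges $2,2,1,1$ the possible values are $c\in\{0,2\}$; for charges $1,2,2,1$ they are $c\in\{1,3\}$. Exchanges are braidings of adjacent anyons, of either handedness. *)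

theory Defs
  imports "HOL-Analysis.Analysis"
begin

section \<open>Kauffman--Lins recoupling data at level 4\<close>

definition kvar :: complex where
  "kvar = \<i> * exp (- \<i> * of_real pi / 12)"

definition qint :: "nat \<Rightarrow> complex" where
  "qint n = (kvar ^ (2 * n) - inverse kvar ^ (2 * n)) / (kvar ^ 2 - inverse kvar ^ 2)"

definition qfact :: "nat \<Rightarrow> complex" where
  "qfact n = (\<Prod>k = 1..n. qint k)"

definition admissible :: "nat \<Rightarrow> nat \<Rightarrow> nat \<Rightarrow> bool" where
  "admissible a b c \<longleftrightarrow>
     even (a + b + c) \<and> a \<le> b + c \<and> b \<le> a + c \<and> c \<le> a + b \<and> a + b + c \<le> 8"

text \<open>
  The evaluations below are the closed formulas of Kauffman and Lins for the closed networks
  (loop, theta net, tetrahedral net) in the Temperley--Lieb recoupling theory. They are meaningful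
  only for admissible triples; all halves and differences are then exact natural numbers.
\<close>

definition loop :: "nat \<Rightarrow> complex" where
  "loop n = (-1) ^ n * qint (n + 1)"

definition theta_net :: "nat \<Rightarrow> nat \<Rightarrow> nat \<Rightarrow> complex" where
  "theta_net a b c =
     (let m = (a + b - c) div 2; n = (b + c - a) div 2; p = (a + c - b) div 2
      in (-1) ^ (m + n + p) * qfact (m + n + p + 1) * qfact m * qfact n * qfact p
         / (qfact (m + n) * qfact (n + p) * qfact (m + p)))"

text \<open>
  \<open>tet a b e c d f\<close> is the tetrahedral net with vertices \<open>(a,d,e)\<close>, \<open>(b,c,e)\<close>, \<open>(a,b,f)\<close>,
  \<open>(c,d,f)\<close>. Lists rather than sets keep repeated factors.
\<close>

definition tet :: "nat \<Rightarrow> nat \<Rightarrow> nat \<Rightarrow> nat \<Rightarrow> nat \<Rightarrow> nat \<Rightarrow> complex" where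
  "tet a b e c d f =
     (let xs = [(a + d + e) div 2, (b + c + e) div 2, (a + b + f) div 2, (c + d + f) div 2];
          ys = [(b + d + e + f) div 2, (a + c + e + f) div 2, (a + b + c + d) div 2]
      in (\<Prod>x\<leftarrow>xs. \<Prod>y\<leftarrow>ys. qfact (y - x)) / (\<Prod>z\<leftarrow>[a, b, c, d, e, f]. qfact z)
         * (\<Sum>s = Max (set xs)..Min (set ys).
              (-1) ^ s * qfact (s + 1)
              / ((\<Prod>x\<leftarrow>xs. qfact (s - x)) * (\<Prod>y\<leftarrow>ys. qfact (y - s)))))"

text \<open>
  With legs \<open>a, b, c, d\<close> in cyclic order, the network joining \<open>a,b\<close> to \<open>c,d\<close> through an edge \<open>j\<close>
  equals the sum over \<open>i\<close> of \<open>sixj a b i c d j\<close> times the network joining \<open>b,c\<close> to \<open>d,a\<close>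
  through an edge \<open>i\<close>.
\<close>

definition sixj :: "nat \<Rightarrow> nat \<Rightarrow> nat \<Rightarrow> nat \<Rightarrow> nat \<Rightarrow> nat \<Rightarrow> complex" where
  "sixj a b i c d j = tet a b i c d j * loop i / (theta_net a d i * theta_net b c i)"

text \<open>
  Removing a crossing of the legs \<open>a, b\<close> of a vertex \<open>(a,b,c)\<close> gives this factor; the crossing of
  the other handedness gives its inverse.
\<close>

definition half_twist :: "nat \<Rightarrow> nat \<Rightarrow> nat \<Rightarrow> complex" where
  "half_twist a b c =
     (-1) ^ ((a + b - c) div 2) *
     kvar powi ((int (a * (a + 2)) + int (b * (b + 2)) - int (c * (c + 2))) div 2)"

datatype handedness = Positive | Negative

fun crossing :: "handedness \<Rightarrow> nat \<Rightarrow> nat \<Rightarrow> nat \<Rightarrow> complex" where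
  "crossing Positive a b c = half_twist a b c"
| "crossing Negative a b c = inverse (half_twist a b c)"


section \<open>Four anyons with total charge 0\<close>

type_synonym charges = "nat \<times> nat \<times> nat \<times> nat"

text \<open>
  A vector is given by its coefficients with respect to the unnormalised fusion trees, indexed by
  the common charge \<open>x\<close> of the first two and of the last two anyons.
\<close>

type_synonym state = "nat \<Rightarrow> complex"

fun channels :: "charges \<Rightarrow> nat set" where
  "channels (a, b, c, d) = {x. x \<le> 4 \<and> admissible a b x \<and> admissible c d x}"

definition fusion_space :: "charges \<Rightarrow> state set" where
  "fusion_space q = {v. \<forall>x. x \<notin> channels q \<longrightarrow> v x = 0}"

text \<open>
  The value of the closed network formed by a tree and its mirror image; trees with different
  intermediate charges are orthogonal.
\<close>

fun tree_norm_sq :: "charges \<Rightarrow> nat \<Rightarrow> complex" where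
  "tree_norm_sq (a, b, c, d) x = theta_net a b x * theta_net c d x / loop x"

definition state_inner :: "charges \<Rightarrow> state \<Rightarrow> state \<Rightarrow> complex" where
  "state_inner q v w = (\<Sum>x \<in> channels q. cnj (v x) * w x * tree_norm_sq q x)"

definition ket :: "charges \<Rightarrow> nat \<Rightarrow> state" where
  "ket q x = (\<lambda>y. if y = x then inverse (of_real (sqrt (Re (tree_norm_sq q x)))) else 0)"

definition orthonormal_kets :: "charges \<Rightarrow> nat set \<Rightarrow> bool" where
  "orthonormal_kets q K \<longleftrightarrow>
     (\<forall>x \<in> K. \<forall>y \<in> K. state_inner q (ket q x) (ket q y) = (if x = y then 1 else 0)) \<and>
     fusion_space q = range (\<lambda>(\<alpha> :: nat \<Rightarrow> complex) y. \<Sum>x \<in> K. \<alpha> x * ket q x y)"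


section \<open>Braids\<close>

text \<open>Exchange of the anyons in the two named positions.\<close>

datatype exchange = X12 handedness | X23 handedness | X34 handedness

fun exchange_charges :: "exchange \<Rightarrow> charges \<Rightarrow> charges" where
  "exchange_charges (X12 _) (a, b, c, d) = (b, a, c, d)"
| "exchange_charges (X23 _) (a, b, c, d) = (a, c, b, d)"
| "exchange_charges (X34 _) (a, b, c, d) = (a, b, d, c)"

text \<open>
  The middle exchange recouples to the trees in which the second and third anyon fuse (to \<open>i\<close>),
  removes the crossing there and recouples back. The second recoupling has the legs
  \<open>c, b, d, a\<close> in cyclic order, starting from the second position.
\<close>

fun exchange_map :: "exchange \<Rightarrow> charges \<Rightarrow> state \<Rightarrow> state" where
  "exchange_map (X12 h) (a, b, c, d) v = (\<lambda>x. crossing h a b x * v x)"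
| "exchange_map (X23 h) (a, b, c, d) v =
     (\<lambda>y. if y \<in> channels (a, c, b, d)
          then \<Sum>x \<in> channels (a, b, c, d). \<Sum>i \<in> channels (b, c, d, a).
                 sixj c b y d a i * crossing h b c i * sixj a b i c d x * v x
          else 0)"
| "exchange_map (X34 h) (a, b, c, d) v = (\<lambda>x. crossing h c d x * v x)"

text \<open>A braid is a list of exchanges, performed from left to right.\<close>

fun braid_charges :: "exchange list \<Rightarrow> charges \<Rightarrow> charges" where
  "braid_charges [] q = q"
| "braid_charges (e # es) q = braid_charges es (exchange_charges e q)"

fun braid_map :: "exchange list \<Rightarrow> charges \<Rightarrow> state \<Rightarrow> state" where
  "braid_map [] q v = v"
| "braid_map (e # es) q v = braid_map es (exchange_charges e q) (exchange_map e q v)"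

end

theory Submission
  imports Defs
begin

text \<open>
  At this value of \<open>A\<close> the quantum integers are \<open>[1] = 1\<close>, \<open>[2] = -\<surd>3\<close>, \<open>[3] = 2\<close>, \<open>[4] = -\<surd>3\<close>, \<open>[5] = 1\<close>,
  so that every network is an element of \<open>\<rat>(\<surd>3)\<close>. After the middle exchange the images of
  \<open>|0\<rangle>\<close> and \<open>|2\<rangle>\<close> already have equal weights on \<open>|1\<rangle>\<close> and \<open>|3\<rangle>\<close>; only the relative phase is wrong,
  by a factor \<open>\<i>\<close>. An exchange of the first two anyons multiplies \<open>|1\<rangle>\<close> by a primitive cube root of
  unity and \<open>|3\<rangle>\<close> by \<open>-exp (\<pi>\<i>/6)\<close>, so three of them act as \<open>diag(1, -\<i>)\<close>. An odd number of
  such exchanges is needed to pass from the charges \<open>2121\<close> to \<open>1221\<close>.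
\<close>

section \<open>Quantum integers at the chosen value of A\<close>

abbreviation sqrt3 :: complex where
  "sqrt3 \<equiv> complex_of_real (sqrt 3)"

lemma sqrt3_mult [simp]:
  "sqrt3 * sqrt3 = 3" "sqrt3 * (sqrt3 * z) = 3 * z" "sqrt3\<^sup>2 = 3"
proof -
  show "sqrt3 * sqrt3 = 3"
    by (metis abs_numeral of_real_mult of_real_numeral real_sqrt_mult_self)
  then show "sqrt3 * (sqrt3 * z) = 3 * z" "sqrt3\<^sup>2 = 3"
    by (simp_all add: power2_eq_square flip: mult.assoc)
qed

lemma sqrt2_mult [simp]:
  "complex_of_real (sqrt 2) * complex_of_real (sqrt 2) = 2"
  by (metis abs_numeral of_real_mult of_real_numeral real_sqrt_mult_self)

lemma kvar_square: "kvar ^ 2 = (\<i> - sqrt3) / 2"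
proof -
  have "kvar ^ 2 = - cis (- (pi / 6))"
    by (simp add: kvar_def power_mult_distrib cis_conv_exp flip: exp_double)
  then show ?thesis
    by (simp add: complex_eq_iff cos_30 sin_30)
qed

lemma inverse_kvar_square: "inverse kvar ^ 2 = - (\<i> + sqrt3) / 2"
proof -
  have "kvar ^ 2 * (- (\<i> + sqrt3) / 2) = 1"
    unfolding kvar_square by (simp add: field_simps)
  then show ?thesis
    by (metis inverse_unique power_inverse)
qed

text \<open>Only even powers of A occur in a quantum integer, so the squares of A and its inverse
  suffice.\<close>

lemma qint_values:
  "qint 1 = 1" "qint 2 = - sqrt3" "qint 3 = 2" "qint 4 = - sqrt3" "qint 5 = 1"
  unfolding qint_def power_mult kvar_square inverse_kvar_square
  by (simp_all add: field_simps eval_nat_numeral)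

lemma qfact_values [simp]:
  "qfact 0 = 1" "qfact (Suc 0) = 1" "qfact 2 = - sqrt3" "qfact 3 = - 2 * sqrt3"
  "qfact 4 = 6" "qfact 5 = 6"
proof -
  have Suc: "qfact (Suc n) = qfact n * qint (Suc n)" for n
    by (simp add: qfact_def)
  show 0: "qfact 0 = 1"
    by (simp add: qfact_def)
  show 1: "qfact (Suc 0) = 1"
    using Suc[of 0] 0 qint_values by simp
  show 2: "qfact 2 = - sqrt3"
    using Suc[of 1] 1 qint_values by (simp flip: numeral_2_eq_2)
  show 3: "qfact 3 = - 2 * sqrt3"
    using Suc[of 2] 2 qint_values by simp
  show 4: "qfact 4 = 6"
    using Suc[of 3] 3 qint_values by simp
  show "qfact 5 = 6"
    using Suc[of 4] 4 qint_values by simp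
qed

section \<open>Networks, recoupling coefficients and crossing factors\<close>

lemma loop_values: "loop 0 = 1" "loop 1 = sqrt3" "loop 2 = 2" "loop 3 = sqrt3"
  using qint_values by (simp_all add: loop_def flip: numeral_2_eq_2)

lemma theta_net_values:
  "theta_net 2 2 0 = 2" "theta_net 1 1 0 = sqrt3" "theta_net 2 2 2 = 2 * sqrt3 / 3"
  "theta_net 1 1 2 = 2"
  "theta_net 2 1 1 = 2" "theta_net 1 2 1 = 2"
  "theta_net 2 1 3 = sqrt3" "theta_net 1 2 3 = sqrt3"
  by (simp_all add: theta_net_def field_simps flip: numeral_2_eq_2)

lemma tet_values:
  "tet 2 2 1 1 1 0 = 2" "tet 2 2 1 1 1 2 = 2 * sqrt3 / 3"
  "tet 2 2 3 1 1 0 = sqrt3" "tet 2 2 3 1 1 2 = - 1"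
  "tet 1 2 1 1 2 1 = - 2 * sqrt3 / 3" "tet 1 2 1 1 2 3 = sqrt3"
  "tet 1 2 3 1 2 1 = sqrt3" "tet 1 2 3 1 2 3 = sqrt3 / 2"
  by (simp_all add: tet_def field_simps flip: numeral_2_eq_2)

text \<open>The first four coefficients recouple 2211 to the trees in which the middle anyons fuse;
  the last four recouple back, to the trees for 2121.\<close>

lemma sixj_values:
  "sixj 2 2 1 1 1 0 = sqrt3 / 2" "sixj 2 2 1 1 1 2 = 1 / 2"
  "sixj 2 2 3 1 1 0 = 1" "sixj 2 2 3 1 1 2 = - sqrt3 / 3"
  "sixj 1 2 1 1 2 1 = - 1 / 2" "sixj 1 2 1 1 2 3 = 3 / 4"
  "sixj 1 2 3 1 2 1 = 1" "sixj 1 2 3 1 2 3 = 1 / 2"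
  unfolding sixj_def tet_values loop_values theta_net_values
  by (simp_all add: field_simps)

lemma half_twist_values:
  "half_twist 2 1 1 = (\<i> * sqrt3 - 1) / 2" "half_twist 1 2 1 = (\<i> * sqrt3 - 1) / 2"
  "half_twist 2 1 3 = - (\<i> + sqrt3) / 2" "half_twist 1 2 3 = - (\<i> + sqrt3) / 2"
proof -
  \<comment> \<open>The twist exponents are (8 + 3 - 3)/2 = 4 in channel 1 and (8 + 3 - 15)/2 = -2
    in channel 3; the sign is -1 only in channel 1.\<close>
  have "kvar ^ 4 = kvar\<^sup>2 * kvar\<^sup>2"
    by (simp flip: power_add)
  also have "\<dots> = (1 - \<i> * sqrt3) / 2"
    unfolding kvar_square by (simp add: field_simps)
  finally have "kvar ^ 4 = (1 - \<i> * sqrt3) / 2" .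
  moreover have "kvar powi (- 2) = - (\<i> + sqrt3) / 2"
    using inverse_kvar_square by (simp add: power_int_minus power_inverse)
  ultimately show
    "half_twist 2 1 1 = (\<i> * sqrt3 - 1) / 2" "half_twist 1 2 1 = (\<i> * sqrt3 - 1) / 2"
    "half_twist 2 1 3 = - (\<i> + sqrt3) / 2" "half_twist 1 2 3 = - (\<i> + sqrt3) / 2"
    by (simp_all add: half_twist_def field_simps)
qed

section \<open>Fusion channels and normalisation of the trees\<close>

lemma channels_values:
  "channels (2, 2, 1, 1) = {0, 2}" "channels (2, 1, 1, 2) = {1, 3}"
  "channels (2, 1, 2, 1) = {1, 3}" "channels (1, 2, 2, 1) = {1, 3}"
proof -
  have le_4: "x \<le> 4 \<longleftrightarrow> x \<in> {0, 1, 2, 3, 4}" for x :: nat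
    by auto
  show
    "channels (2, 2, 1, 1) = {0, 2}" "channels (2, 1, 1, 2) = {1, 3}"
    "channels (2, 1, 2, 1) = {1, 3}" "channels (1, 2, 2, 1) = {1, 3}"
    by (auto simp: le_4 admissible_def)
qed

lemma tree_norm_sq_values:
  "tree_norm_sq (2, 2, 1, 1) 0 = of_real (2 * sqrt 3)"
  "tree_norm_sq (2, 2, 1, 1) 2 = of_real (2 * sqrt 3 / 3)"
  "tree_norm_sq (1, 2, 2, 1) 1 = of_real (4 * sqrt 3 / 3)"
  "tree_norm_sq (1, 2, 2, 1) 3 = of_real (sqrt 3)"
  unfolding tree_norm_sq.simps theta_net_values loop_values
  by (simp_all add: field_simps)

text \<open>Since \<open>state_inner\<close> is diagonal in the trees, only the unit norms depend on
  positivity. It also makes \<open>ket q x x\<close> nonzero, so dividing a coefficient by it gives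
  the expansion in the kets.\<close>

lemma orthonormal_ketsI:
  assumes "finite (channels q)"
    and pos: "\<And>x. x \<in> channels q \<Longrightarrow> \<exists>r > 0. tree_norm_sq q x = of_real r"
  shows "orthonormal_kets q (channels q)"
proof -
  have "state_inner q (ket q x) (ket q y) = (if x = y then 1 else 0)"
    if "x \<in> channels q" "y \<in> channels q" for x y
  proof -
    obtain r where r: "r > 0" "tree_norm_sq q x = of_real r"
      using pos \<open>x \<in> channels q\<close> by blast
    have "state_inner q (ket q x) (ket q y) =
        (\<Sum>z \<in> channels q. if z = x then cnj (ket q x x) * ket q y x * tree_norm_sq q x else 0)"
      unfolding state_inner_def by (intro sum.cong) (auto simp: ket_def)
    also have "\<dots> = cnj (ket q x x) * ket q y x * of_real r"
      using assms(1) \<open>x \<in> channels q\<close> r by simp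
    also have "\<dots> = (if x = y then 1 else 0)"
    proof (cases "x = y")
      case True
      have "inverse (sqrt r) * inverse (sqrt r) * r = 1"
        using r by (simp add: field_simps)
      then have "complex_of_real (inverse (sqrt r) * inverse (sqrt r) * r) = 1"
        by simp
      with True r show ?thesis
        by (simp add: ket_def)
    qed (simp add: ket_def)
    finally show ?thesis .
  qed
  moreover have "fusion_space q = range (\<lambda>(\<alpha> :: nat \<Rightarrow> complex) y. \<Sum>x \<in> channels q. \<alpha> x * ket q x y)"
  proof (intro equalityI subsetI)
    fix v assume v: "v \<in> fusion_space q"
    have "v = (\<lambda>y. \<Sum>x \<in> channels q. (v x / ket q x x) * ket q x y)"
    proof
      fix y
      have "(\<Sum>x \<in> channels q. (v x / ket q x x) * ket q x y) =
          (\<Sum>x \<in> channels q. if x = y then v y / ket q y y * ket q y y else 0)"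
        by (intro sum.cong) (auto simp: ket_def)
      also have "\<dots> = v y"
        using assms(1) v pos[of y] by (auto simp: fusion_space_def ket_def)
      finally show "v y = (\<Sum>x \<in> channels q. (v x / ket q x x) * ket q x y)" ..
    qed
    then show "v \<in> range (\<lambda>(\<alpha> :: nat \<Rightarrow> complex) y. \<Sum>x \<in> channels q. \<alpha> x * ket q x y)"
      by (intro image_eqI[where x = "\<lambda>x. v x / ket q x x"]) simp_all
  next
    fix v assume "v \<in> range (\<lambda>(\<alpha> :: nat \<Rightarrow> complex) y. \<Sum>x \<in> channels q. \<alpha> x * ket q x y)"
    then show "v \<in> fusion_space q"
      by (auto simp: fusion_space_def ket_def intro!: sum.neutral)
  qed
  ultimately show ?thesis
    by (simp add: orthonormal_kets_def)
qed

section \<open>The braid and its matrix\<close>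

text \<open>The handedness changes after the middle exchange: recoupling coefficients are real, so a
  positive middle exchange would conjugate the relative phases and swap the signs in the two
  images.\<close>

definition qubit_braid :: "exchange list" where
  "qubit_braid = X23 Negative # map X12 [Positive, Positive, Positive]"

text \<open>This is exp (2\<pi>\<i>/3), the phase of the image of \<open>|0>\<close>.\<close>

definition cube_root :: complex where
  "cube_root = (\<i> * sqrt3 - 1) / 2"

lemma norm_cube_root: "cmod cube_root = 1"
proof -
  have eq: "cube_root = Complex (- 1 / 2) (sqrt 3 / 2)"
    by (simp add: cube_root_def complex_eq_iff)
  show ?thesis
    unfolding eq complex_norm by (simp add: power_divide)
qed

lemma crossing_values:
  "crossing Positive 2 1 1 = (\<i> * sqrt3 - 1) / 2"
  "crossing Positive 1 2 1 = (\<i> * sqrt3 - 1) / 2"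
  "crossing Positive 2 1 3 = - (\<i> + sqrt3) / 2"
  "crossing Positive 1 2 3 = - (\<i> + sqrt3) / 2"
  "crossing Negative 2 1 1 = - (\<i> * sqrt3 + 1) / 2"
  "crossing Negative 2 1 3 = (\<i> - sqrt3) / 2"
  unfolding crossing.simps half_twist_values
  by (rule refl | rule inverse_unique; simp add: field_simps)+

text \<open>The matrix refers to unnormalised trees. The final 0 is the default of the middle
  exchange, preserved by the diagonal exchanges that follow.\<close>

lemma braid_map_qubit_braid:
  "braid_map qubit_braid (2, 2, 1, 1) v =
    (\<lambda>y. if y = 1 then cube_root * sqrt3 / 2 * v 0 + v 2 / 2
         else if y = 3 then cube_root * v 0 - sqrt3 / 3 * v 2 else 0)"
  unfolding qubit_braid_def braid_map.simps exchange_charges.simps exchange_map.simps list.map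
    channels_values
  by (simp add: sixj_values[unfolded One_nat_def] crossing_values[unfolded One_nat_def]
      fun_eq_iff cube_root_def del: crossing.simps) (simp add: field_simps)

text \<open>All four squared norms are rational multiples of \<open>sqrt 3\<close>. Pulling out the
  common fourth root \<open>t\<close> leaves only square roots to compare.\<close>

lemma ket_values:
  defines "t \<equiv> complex_of_real (1 / sqrt (sqrt 3))"
  shows "ket (2, 2, 1, 1) 0 = (\<lambda>y. if y = 0 then t / of_real (sqrt 2) else 0)"
    and "ket (2, 2, 1, 1) 2 = (\<lambda>y. if y = 2 then t * sqrt3 / of_real (sqrt 2) else 0)"
    and "ket (1, 2, 2, 1) 1 = (\<lambda>y. if y = 1 then t * sqrt3 / 2 else 0)"
    and "ket (1, 2, 2, 1) 3 = (\<lambda>y. if y = 3 then t else 0)"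
  unfolding ket_def tree_norm_sq_values Re_complex_of_real t_def
  by (simp_all add: fun_eq_iff real_sqrt_mult real_sqrt_divide field_simps)

lemma braid_map_qubit_braid_surj:
  "braid_map qubit_braid (2, 2, 1, 1) ` fusion_space (2, 2, 1, 1) = fusion_space (1, 2, 2, 1)"
proof (intro equalityI subsetI)
  fix w assume "w \<in> braid_map qubit_braid (2, 2, 1, 1) ` fusion_space (2, 2, 1, 1)"
  then show "w \<in> fusion_space (1, 2, 2, 1)"
    unfolding fusion_space_def channels_values braid_map_qubit_braid by auto
next
  fix w assume "w \<in> fusion_space (1, 2, 2, 1)"
  then have w: "w x = 0" if "x \<noteq> 1" "x \<noteq> 3" for x
    using that unfolding fusion_space_def channels_values by blast
  \<comment> \<open>The preimage comes from inverting the 2 by 2 matrix of the braid, whose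
    determinant is \<open>- cube_root\<close>.\<close>
  define v :: state where
    "v = (\<lambda>x. if x = 0 then (sqrt3 / 3 * w 1 + w 3 / 2) / cube_root
               else if x = 2 then w 1 - sqrt3 / 2 * w 3 else 0)"
  have "cube_root \<noteq> 0"
    using norm_cube_root by auto
  then have "w = braid_map qubit_braid (2, 2, 1, 1) v"
    unfolding braid_map_qubit_braid using w by (auto simp: fun_eq_iff v_def field_simps)
  moreover have "v \<in> fusion_space (2, 2, 1, 1)"
    unfolding fusion_space_def channels_values by (simp add: v_def)
  ultimately show "w \<in> braid_map qubit_braid (2, 2, 1, 1) ` fusion_space (2, 2, 1, 1)"
    by blast
qed

theorem mainTheorem4:
  shows "orthonormal_kets (2, 2, 1, 1) {0, 2} \<and> orthonormal_kets (1, 2, 2, 1) {1, 3} \<and>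
    (\<exists>(h :: handedness) (hs :: handedness list).
       let \<beta> = X23 h # map X12 hs in
         length hs \<ge> 2 \<and>
         braid_charges \<beta> (2, 2, 1, 1) = (1, 2, 2, 1) \<and>
         braid_map \<beta> (2, 2, 1, 1) ` fusion_space (2, 2, 1, 1) = fusion_space (1, 2, 2, 1) \<and>
         (\<exists>\<omega> :: complex. cmod \<omega> = 1 \<and>
            braid_map \<beta> (2, 2, 1, 1) (ket (2, 2, 1, 1) 0) =
              (\<lambda>x. \<omega> * (1 / of_real (sqrt 2) * (ket (1, 2, 2, 1) 1 x + ket (1, 2, 2, 1) 3 x)))) \<and>
         (\<exists>\<omega> :: complex. cmod \<omega> = 1 \<and>
            braid_map \<beta> (2, 2, 1, 1) (ket (2, 2, 1, 1) 2) =
              (\<lambda>x. \<omega> * (1 / of_real (sqrt 2) * (ket (1, 2, 2, 1) 1 x - ket (1, 2, 2, 1) 3 x)))))"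
proof -
  have "orthonormal_kets (2, 2, 1, 1) {0, 2}"
    by (rule orthonormal_ketsI[of "(2, 2, 1, 1)", unfolded channels_values])
      (auto simp: tree_norm_sq_values[unfolded One_nat_def] simp del: tree_norm_sq.simps
        intro: exI[of _ "2 * sqrt 3"] exI[of _ "2 * sqrt 3 / 3"])
  moreover have "orthonormal_kets (1, 2, 2, 1) {1, 3}"
    by (rule orthonormal_ketsI[of "(1, 2, 2, 1)", unfolded channels_values])
      (auto simp: tree_norm_sq_values[unfolded One_nat_def] simp del: tree_norm_sq.simps
        intro: exI[of _ "4 * sqrt 3 / 3"])
  \<comment> \<open>Normalisation equalises the weights: in channel 1 both columns give
    \<open>t * sqrt3 / (2 * sqrt 2)\<close> and in channel 3 plus or minus
    \<open>t / sqrt 2\<close>, up to the phase.\<close>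
  moreover have "braid_map qubit_braid (2, 2, 1, 1) (ket (2, 2, 1, 1) 0) =
      (\<lambda>x. cube_root * (1 / of_real (sqrt 2) * (ket (1, 2, 2, 1) 1 x + ket (1, 2, 2, 1) 3 x)))"
    unfolding braid_map_qubit_braid ket_values by (auto simp: fun_eq_iff field_simps)
  moreover have "braid_map qubit_braid (2, 2, 1, 1) (ket (2, 2, 1, 1) 2) =
      (\<lambda>x. 1 * (1 / of_real (sqrt 2) * (ket (1, 2, 2, 1) 1 x - ket (1, 2, 2, 1) 3 x)))"
    unfolding braid_map_qubit_braid ket_values by (auto simp: fun_eq_iff field_simps)
  moreover have "braid_charges qubit_braid (2, 2, 1, 1) = (1, 2, 2, 1)"
    by (simp add: qubit_braid_def)
  ultimately show ?thesis
    using braid_map_qubit_braid_surj norm_cube_root norm_one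
    unfolding Let_def qubit_braid_def
    by (intro conjI exI[of _ Negative] exI[of _ "[Positive, Positive, Positive]"])
      (assumption | simp; fail | blast)+
qed

end
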